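(* Let $(P_0,f_0)\in\mathcal{R}$ and $V\in(T\mathcal{R})_{(P_0,f_0)}$, and let $x_0\in\mathbb{R}$, $\vec{x}$, $A$ be the entries determined by $V$, so that the liftings of $V$ are exactly the operators $$\begin{pmatrix} \begin{matrix} i x_0 & \vec{x}\\ -\vec{\bar{x}}^t & Y\end{matrix} & A\\ -A^* & Z\end{pmatrix}$$ with $Y$ and $Z$ arbitrary anti-Hermitian operators acting in $R(P_0)\ominus\langle f_0\rangle$ and $N(P_0)$, respectively. Suppose that $Y_0$ and $Z_0$ are anti-Hermitian operators acting respectively in $R(P_0)\ominus\langle f_0\rangle$ and $N(P_0)$, where $Y_0$ minimizes, over all anti-Hermitian $Y$ in $R(P_0)\ominus\langle f_0\rangle$, the norm of the row $$\begin{pmatrix} \begin{matrix} i x_0 & \vec{x}\\ -\vec{\bar{x}}^t & Y\end{matrix} & A\end{pmatrix},$$ and $Z_0$ minimizes, over all anti-Hermitian $Z$ in $N(P_0)$, the norm of the matrix $$\begin{pmatrix} \begin{matrix} i x_0 & \vec{x}\\ -\vec{\bar{x}}^t & Y_0\end{matrix} & A\\ -A^* & Z\end{pmatrix}.$$ Then $$X_0=\begin{pmatrix} \begin{matrix} i x_0 & \vec{x}\\ -\vec{\bar{x}}^t & Y_0\end{matrix} & A\\ -A^* & Z_0\end{pmatrix}$$ is a minimal lifting of $V$. Moreover, any minimal lifting of $V$ can be obtained in this fashion.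
   Context: $\mathcal{H}$ is a complex Hilbert space; $\mathcal{P}(\mathcal{H})$ the orthogonal projections; $\mathcal{R}=\{(P,f)\in\mathcal{P}(\mathcal{H})\times\mathcal{H}: Pf=f,\ \|f\|=1\}$; $\mathcal{B}_{ah}(\mathcal{H})$ the anti-Hermitian bounded operators. The tangent space is $(T\mathcal{R})_{(P_0,f_0)}=\{(XP_0-P_0X,Xf_0): X\in\mathcal{B}_{ah}(\mathcal{H})\}$ and $\delta_{(P_0,f_0)}:\mathcal{B}_{ah}(\mathcal{H})\to(T\mathcal{R})_{(P_0,f_0)}$ is $\delta_{(P_0,f_0)}(X)=(XP_0-P_0X,Xf_0)$. A lifting of $V$ is an $X\in\mathcal{B}_{ah}(\mathcal{H})$ with $\delta_{(P_0,f_0)}(X)=V$; a minimal lifting is a lifting whose operator norm is the smallest among all liftings of $V$. Matrices are written with respect to $\mathcal{H}=\big(\langle f_0\rangle\oplus(R(P_0)\ominus\langle f_0\rangle)\big)\oplus N(P_0)$, where $\langle f_0\rangle$ is the line spanned by $f_0$ and $R(P_0)\ominus\langle f_0\rangle$ its orthogonal complement in $R(P_0)$; here $A:N(P_0)\to R(P_0)$ is bounded, $\vec{x}$ is a bounded operator $R(P_0)\ominus\langle f_0\rangle\to\langle f_0\rangle$ and $\vec{\bar{x}}^t$ is its adjoint. The row is regarded as an operator from $R(P_0)\oplus N(P_0)$ to $R(P_0)$. All norms are operator norms. *)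

theory Defs
  imports "HOL-Analysis.Analysis"
begin

section \<open>Complex Hilbert spaces\<close>

class complex_vector = real_vector +
  fixes scaleC :: "complex \<Rightarrow> 'a \<Rightarrow> 'a" (infixr "*\<^sub>C" 75)
  assumes scaleC_add_right: "c *\<^sub>C (x + y) = c *\<^sub>C x + c *\<^sub>C y"
    and scaleC_add_left: "(c + d) *\<^sub>C x = c *\<^sub>C x + d *\<^sub>C x"
    and scaleC_scaleC: "c *\<^sub>C d *\<^sub>C x = (c * d) *\<^sub>C x"
    and scaleR_scaleC: "r *\<^sub>R x = complex_of_real r *\<^sub>C x"

text \<open>The complex inner product is conjugate linear in the first argument. The norm is that of
  the underlying real inner product space, so \<open>norm x = sqrt (Re (cinner x x))\<close>, and
  positive definiteness is inherited from \<^class>\<open>real_inner\<close>.\<close>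

class complex_inner = complex_vector + real_inner +
  fixes cinner :: "'a \<Rightarrow> 'a \<Rightarrow> complex"
  assumes cinner_commute: "cinner x y = cnj (cinner y x)"
    and cinner_add_right: "cinner x (y + z) = cinner x y + cinner x z"
    and cinner_scaleC_right: "cinner x (c *\<^sub>C y) = c * cinner x y"
    and inner_eq_Re_cinner: "inner x y = Re (cinner x y)"

class chilbert_space = complex_inner + complete_space

instantiation complex :: chilbert_space
begin
definition "c *\<^sub>C (z::complex) = c * z"
definition "cinner (w::complex) z = cnj w * z"
instance
  by standard (auto simp: scaleC_complex_def cinner_complex_def algebra_simps
      scaleR_conv_of_real inner_complex_def)
end

lemma scaleC_one [simp]: "1 *\<^sub>C (x::'a::complex_vector) = x"
  using scaleR_scaleC[of 1 x] by simp

lemma scaleC_zero_left [simp]: "0 *\<^sub>C (x::'a::complex_vector) = 0"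
  using scaleR_scaleC[of 0 x] by simp

lemma scaleC_zero_right [simp]: "c *\<^sub>C (0::'a::complex_vector) = 0"
  using scaleC_add_right[of c 0 0] by simp

lemma scaleC_minus_right [simp]: "c *\<^sub>C (- x) = - (c *\<^sub>C (x::'a::complex_vector))"
  using scaleC_add_right[of c x "- x"] by (simp add: eq_neg_iff_add_eq_0 add.commute)

lemma scaleC_diff_right: "c *\<^sub>C (x - y) = c *\<^sub>C x - c *\<^sub>C (y::'a::complex_vector)"
  using scaleC_add_right[of c x "- y"] by simp

lemma cinner_add_left: "cinner (x + y) z = cinner x z + cinner (y::'a::complex_inner) z"
  by (metis cinner_add_right cinner_commute complex_cnj_add)

lemma cinner_scaleC_left: "cinner (c *\<^sub>C x) y = cnj c * cinner (x::'a::complex_inner) y"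
  by (metis cinner_commute cinner_scaleC_right complex_cnj_mult)

lemma cinner_zero [simp]: "cinner 0 x = 0" "cinner (x::'a::complex_inner) 0 = 0"
  using cinner_scaleC_left[of 0 0 x] cinner_scaleC_right[of x 0 0] by simp_all

lemma cinner_minus [simp]:
  "cinner (- x) y = - cinner x y" "cinner x (- y) = - cinner (x::'a::complex_inner) y"
  using cinner_add_left[of x "- x" y] cinner_add_right[of x y "- y"]
  by (simp_all add: eq_neg_iff_add_eq_0 add.commute)

lemma cinner_diff_left: "cinner (x - y) z = cinner x z - cinner (y::'a::complex_inner) z"
  using cinner_add_left[of x "- y" z] by simp

lemma cinner_diff_right: "cinner x (y - z) = cinner x y - cinner (x::'a::complex_inner) z"
  using cinner_add_right[of x y "- z"] by simp

lemma cinner_eq_inner: "cinner x y = Complex (inner x y) (inner (\<i> *\<^sub>C x) (y::'a::complex_inner))"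
  by (simp add: inner_eq_Re_cinner cinner_scaleC_left complex_eq_iff)

lemma cinner_self: "cinner x x = complex_of_real ((norm (x::'a::complex_inner))\<^sup>2)"
proof -
  have "Im (cinner x x) = 0"
    using cinner_commute[of x x] by (metis Reals_cnj_iff complex_is_Real_iff)
  then show ?thesis
    by (simp add: complex_eq_iff inner_eq_Re_cinner[symmetric] power2_norm_eq_inner)
qed

lemma cinner_ext_left:
  assumes "\<And>z. cinner x z = cinner (y::'a::complex_inner) z" shows "x = y"
  by (metis assms inner_eq_Re_cinner inner_commute vector_eq_rdot)

lemma norm_scaleC [simp]: "norm (c *\<^sub>C x) = cmod c * norm (x::'a::complex_inner)"
proof -
  have "complex_of_real ((norm (c *\<^sub>C x))\<^sup>2) = (c * cnj c) * cinner x x"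
    unfolding cinner_self[symmetric] cinner_scaleC_left cinner_scaleC_right
    by (simp only: mult_ac)
  also have "\<dots> = complex_of_real ((cmod c)\<^sup>2 * (norm x)\<^sup>2)"
    by (simp only: cinner_self complex_norm_square[symmetric] of_real_mult)
  also have "\<dots> = complex_of_real ((cmod c * norm x)\<^sup>2)"
    by (simp only: power_mult_distrib)
  finally have "(norm (c *\<^sub>C x))\<^sup>2 = (cmod c * norm x)\<^sup>2"
    by (simp only: of_real_eq_iff)
  then show ?thesis by (simp add: power2_eq_iff_nonneg)
qed

lemma norm_cinner_le: "cmod (cinner x y) \<le> norm x * norm (y::'a::complex_inner)"
proof (cases "cinner x y = 0")
  case False
  define z where "z = cinner x y"
  define c where "c = cnj z / complex_of_real (cmod z)"
  have z: "cmod z \<noteq> 0" using False by (simp add: z_def)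
  then have c: "cmod c = 1" by (simp add: c_def norm_divide)
  have "c * z = (z * cnj z) / complex_of_real (cmod z)"
    by (simp add: c_def)
  also have "\<dots> = complex_of_real (cmod z * cmod z / cmod z)"
    by (simp only: complex_norm_square[symmetric] of_real_divide power2_eq_square)
  finally have "Re (c * z) = cmod z"
    using z by simp
  then have "cmod z = inner x (c *\<^sub>C y)"
    by (simp only: inner_eq_Re_cinner cinner_scaleC_right z_def)
  also have "\<dots> \<le> norm x * norm (c *\<^sub>C y)" by (rule norm_cauchy_schwarz)
  finally show ?thesis using c by (simp add: z_def)
qed simp


section \<open>Bounded complex-linear operators between closed subspaces\<close>

definition clinear_op :: "('a::complex_inner \<Rightarrow>\<^sub>L 'b::complex_inner) \<Rightarrow> bool" where
  "clinear_op T \<longleftrightarrow> (\<forall>c x. T (c *\<^sub>C x) = c *\<^sub>C T x)"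

definition ortho :: "'a::complex_inner set \<Rightarrow> 'a set" where
  "ortho S = {v. \<forall>s\<in>S. cinner s v = 0}"

text \<open>A bounded operator from a closed subspace \<open>S\<close> to a closed subspace \<open>T\<close> is represented by
  its extension by zero on the orthogonal complement of \<open>S\<close>. This does not change the operator
  norm, and an operator matrix becomes the sum of its entries.\<close>

definition ops :: "'a::complex_inner set \<Rightarrow> 'a set \<Rightarrow> ('a \<Rightarrow>\<^sub>L 'a) set" where
  "ops S T = {B. clinear_op B \<and> (\<forall>v. B v \<in> T) \<and> (\<forall>v\<in>ortho S. B v = 0)}"

definition is_adjoint ::
    "('b::complex_inner \<Rightarrow>\<^sub>L 'a::complex_inner) \<Rightarrow> ('a \<Rightarrow>\<^sub>L 'b) \<Rightarrow> bool" where
  "is_adjoint S T \<longleftrightarrow> (\<forall>x y. cinner (S y) x = cinner y (T x))"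

definition cadjoint ::
    "('a::complex_inner \<Rightarrow>\<^sub>L 'b::complex_inner) \<Rightarrow> ('b \<Rightarrow>\<^sub>L 'a)" where
  "cadjoint T = (THE S. is_adjoint S T)"

lemma is_adjoint_unique: "is_adjoint S T \<Longrightarrow> is_adjoint S' T \<Longrightarrow> S = S'"
  unfolding is_adjoint_def by (metis blinfun_eqI cinner_ext_left)

lemma cadjoint_eqI: "is_adjoint S T \<Longrightarrow> cadjoint T = S"
  unfolding cadjoint_def by (blast intro: is_adjoint_unique)

text \<open>Existence of adjoints, by the Riesz representation theorem.\<close>

lemma riesz_real:
  fixes \<phi> :: "'a::{real_inner, complete_space} \<Rightarrow> real"
  assumes "bounded_linear \<phi>"
  shows "\<exists>z. \<forall>x. \<phi> x = inner z x"
proof (cases "\<forall>x. \<phi> x = 0")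
  case True
  then show ?thesis by (intro exI[of _ 0]) simp
next
  case False
  interpret \<phi>: bounded_linear \<phi> by fact
  define K where "K = {x. \<phi> x = 1}"
  define d where "d = (INF x\<in>K. (norm x)\<^sup>2)"
  obtain w where "\<phi> w \<noteq> 0" using False by blast
  then have "(1 / \<phi> w) *\<^sub>R w \<in> K" by (simp add: K_def \<phi>.scaleR)
  then have ne: "K \<noteq> {}" by blast
  have bdd: "bdd_below ((\<lambda>x. (norm x)\<^sup>2) ` K)" by (rule bdd_belowI[of _ 0]) auto
  have d_le: "d \<le> (norm x)\<^sup>2" if "x \<in> K" for x
    unfolding d_def by (rule cINF_lower[OF bdd that])
  have "\<exists>x\<in>K. (norm x)\<^sup>2 < d + inverse (real (Suc n))" for n
    using ne bdd by (subst cINF_less_iff[symmetric]) (auto simp: d_def[symmetric])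
  then obtain X where X: "\<And>n. X n \<in> K" "\<And>n. (norm (X n))\<^sup>2 < d + inverse (real (Suc n))"
    by metis
  have par: "(norm (X m - X n))\<^sup>2 \<le> 2 * inverse (real (Suc m)) + 2 * inverse (real (Suc n))" for m n
  proof -
    have "(1/2) *\<^sub>R (X m + X n) \<in> K"
      using X(1)[of m] X(1)[of n] by (simp add: K_def \<phi>.scaleR \<phi>.add)
    then have "d \<le> (norm ((1/2) *\<^sub>R (X m + X n)))\<^sup>2" by (rule d_le)
    then have "4 * d \<le> (norm (X m + X n))\<^sup>2" by (simp add: power_divide)
    moreover have "(norm (X m - X n))\<^sup>2 = 2 * (norm (X m))\<^sup>2 + 2 * (norm (X n))\<^sup>2 - (norm (X m + X n))\<^sup>2"
      by (simp add: power2_norm_eq_inner inner_simps inner_commute)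
    ultimately show ?thesis using X(2)[of m] X(2)[of n] by linarith
  qed
  have "Cauchy X"
  proof (rule metric_CauchyI)
    fix e :: real assume "e > 0"
    then obtain N where N: "inverse (real (Suc N)) < e\<^sup>2 / 4"
      using reals_Archimedean[of "e\<^sup>2 / 4"] by auto
    have "dist (X m) (X n) < e" if "m \<ge> N" "n \<ge> N" for m n
    proof -
      have "inverse (real (Suc m)) \<le> inverse (real (Suc N))"
        "inverse (real (Suc n)) \<le> inverse (real (Suc N))"
        using that by (simp_all add: field_simps)
      then have "(norm (X m - X n))\<^sup>2 < e\<^sup>2" using par[of m n] N by linarith
      then show ?thesis using \<open>e > 0\<close> by (simp add: dist_norm power_less_imp_less_base)
    qed
    then show "\<exists>M. \<forall>m\<ge>M. \<forall>n\<ge>M. dist (X m) (X n) < e" by blast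
  qed
  then obtain u where u: "X \<longlonglongrightarrow> u" using convergent_eq_Cauchy by blast
  have "(\<lambda>n. \<phi> (X n)) \<longlonglongrightarrow> \<phi> u" by (rule \<phi>.tendsto[OF u])
  moreover have "(\<lambda>n. \<phi> (X n)) = (\<lambda>n. 1)" using X(1) by (simp add: K_def)
  ultimately have \<phi>u: "\<phi> u = 1" using LIMSEQ_unique tendsto_const by metis
  have "(\<lambda>n. d + inverse (real (Suc n))) \<longlonglongrightarrow> d + 0"
    by (intro tendsto_add tendsto_const LIMSEQ_inverse_real_of_nat)
  from LIMSEQ_le[OF tendsto_power[OF tendsto_norm[OF u], of 2] this]
  have ud: "(norm u)\<^sup>2 \<le> d" using X(2) by (simp add: less_imp_le)
  have perp: "inner u v = 0" if v: "\<phi> v = 0" for v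
  proof (cases "v = 0")
    case False
    define t where "t = - inner u v / (norm v)\<^sup>2"
    have "u + t *\<^sub>R v \<in> K" using \<phi>u v by (simp add: K_def \<phi>.add \<phi>.scaleR)
    then have "(norm u)\<^sup>2 \<le> (norm (u + t *\<^sub>R v))\<^sup>2" using ud d_le[of "u + t *\<^sub>R v"] by linarith
    also have "\<dots> = (norm u)\<^sup>2 + 2 * t * inner u v + t * t * (norm v)\<^sup>2"
      by (simp add: power2_norm_eq_inner inner_simps inner_commute algebra_simps)
    also have "\<dots> = (norm u)\<^sup>2 - (inner u v)\<^sup>2 / (norm v)\<^sup>2"
      using False by (simp add: t_def field_simps power2_eq_square)
    finally have "(inner u v)\<^sup>2 / (norm v)\<^sup>2 \<le> 0" by simp
    then show ?thesis using False by (simp add: divide_le_0_iff)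
  qed simp
  have u0: "u \<noteq> 0" using \<phi>u \<phi>.zero by force
  have "\<phi> x = inner ((1 / (norm u)\<^sup>2) *\<^sub>R u) x" for x
  proof -
    have "inner u (x - \<phi> x *\<^sub>R u) = 0"
      by (rule perp) (simp add: \<phi>.diff \<phi>.scaleR \<phi>u)
    then show ?thesis using u0 by (simp add: inner_simps power2_norm_eq_inner)
  qed
  then show ?thesis by blast
qed

lemma is_adjoint_cadjoint:
  fixes T :: "'a::chilbert_space \<Rightarrow>\<^sub>L 'b::complex_inner"
  assumes "clinear_op T"
  shows "is_adjoint (cadjoint T) T"
proof -
  have "\<exists>z. \<forall>x. inner y (T x) = inner z x" for y
    by (rule riesz_real) (intro bounded_linear_intros)
  then obtain S where S: "\<And>y x. inner y (T x) = inner (S y) x" by metis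
  have "inner (\<i> *\<^sub>C y) (T x) = inner (\<i> *\<^sub>C S y) x" for x y
  proof -
    have "inner (\<i> *\<^sub>C y) (T x) = inner y (T (- \<i> *\<^sub>C x))"
      using assms by (simp add: clinear_op_def inner_eq_Re_cinner cinner_scaleC_left cinner_scaleC_right)
    also have "\<dots> = inner (S y) (- \<i> *\<^sub>C x)" by (rule S)
    also have "\<dots> = inner (\<i> *\<^sub>C S y) x"
      by (simp add: inner_eq_Re_cinner cinner_scaleC_left cinner_scaleC_right)
    finally show ?thesis .
  qed
  then have SC: "cinner (S y) x = cinner y (T x)" for x y
    using S[of y x] by (simp add: cinner_eq_inner)
  have "bounded_linear S"
  proof (rule bounded_linear_intro[where K = "norm T"])
    fix x y :: 'b and r :: real
    show "S (x + y) = S x + S y"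
      by (rule cinner_ext_left) (simp add: SC cinner_add_left)
    show "S (r *\<^sub>R x) = r *\<^sub>R S x"
      by (rule cinner_ext_left) (simp add: SC scaleR_scaleC cinner_scaleC_left)
    have "norm (S x) * norm (S x) = inner x (T (S x))"
      by (simp add: S power2_norm_eq_inner flip: power2_eq_square)
    also have "\<dots> \<le> norm x * (norm T * norm (S x))"
      by (rule order_trans[OF norm_cauchy_schwarz]) (simp add: mult_left_mono norm_blinfun)
    finally have "norm (S x) * norm (S x) \<le> (norm x * norm T) * norm (S x)" by (simp only: mult.assoc)
    then show "norm (S x) \<le> norm x * norm T"
      by (metis mult_right_le_imp_le norm_ge_zero mult_nonneg_nonneg order_le_less)
  qed
  then have "is_adjoint (Blinfun S) T"
    by (simp add: is_adjoint_def bounded_linear_Blinfun_apply SC)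
  then show ?thesis using cadjoint_eqI by metis
qed

text \<open>Bounded anti-Hermitian operators acting in the closed subspace \<open>S\<close>.\<close>

definition antiherm_on :: "'a::complex_inner set \<Rightarrow> ('a \<Rightarrow>\<^sub>L 'a) set" where
  "antiherm_on S = {Y \<in> ops S S. is_adjoint (- Y) Y}"

definition orth_projections :: "('a::complex_inner \<Rightarrow>\<^sub>L 'a) set" where
  "orth_projections = {P. clinear_op P \<and> P o\<^sub>L P = P \<and> is_adjoint P P}"


section \<open>The space of pairs and its tangent spaces\<close>

definition proj_vec_pairs :: "(('a::complex_inner \<Rightarrow>\<^sub>L 'a) \<times> 'a) set" where
  "proj_vec_pairs = {(P, f). P \<in> orth_projections \<and> P f = f \<and> norm f = 1}"

definition delta ::
    "('a::complex_inner \<Rightarrow>\<^sub>L 'a) \<Rightarrow> 'a \<Rightarrow> ('a \<Rightarrow>\<^sub>L 'a) \<Rightarrow> ('a \<Rightarrow>\<^sub>L 'a) \<times> 'a" where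
  "delta P f X = ((X o\<^sub>L P) - (P o\<^sub>L X), X f)"

definition tangent_space ::
    "('a::complex_inner \<Rightarrow>\<^sub>L 'a) \<Rightarrow> 'a \<Rightarrow> (('a \<Rightarrow>\<^sub>L 'a) \<times> 'a) set" where
  "tangent_space P f = delta P f ` antiherm_on UNIV"

definition liftings ::
    "('a::complex_inner \<Rightarrow>\<^sub>L 'a) \<Rightarrow> 'a \<Rightarrow> ('a \<Rightarrow>\<^sub>L 'a) \<times> 'a \<Rightarrow> ('a \<Rightarrow>\<^sub>L 'a) set" where
  "liftings P f V = {X \<in> antiherm_on UNIV. delta P f X = V}"

definition minimal_lifting ::
    "('a::complex_inner \<Rightarrow>\<^sub>L 'a) \<Rightarrow> 'a \<Rightarrow> ('a \<Rightarrow>\<^sub>L 'a) \<times> 'a \<Rightarrow> ('a \<Rightarrow>\<^sub>L 'a) \<Rightarrow> bool" where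
  "minimal_lifting P f V X \<longleftrightarrow> is_arg_min norm (\<lambda>X. X \<in> liftings P f V) X"


section \<open>Operator matrices\<close>

definition cline :: "'a::complex_inner \<Rightarrow> 'a set" where
  "cline f = range (\<lambda>c. c *\<^sub>C f)"

definition rng :: "('a::complex_inner \<Rightarrow>\<^sub>L 'a) \<Rightarrow> 'a set" where
  "rng P = range (blinfun_apply P)"

definition nul :: "('a::complex_inner \<Rightarrow>\<^sub>L 'a) \<Rightarrow> 'a set" where
  "nul P = {v. P v = 0}"

definition rng_minus :: "('a::complex_inner \<Rightarrow>\<^sub>L 'a) \<Rightarrow> 'a \<Rightarrow> 'a set" where
  "rng_minus P f = rng P \<inter> ortho (cline f)"

text \<open>For a unit vector \<open>f\<close>, the operator of multiplication by \<open>c\<close> on the line spanned by \<open>f\<close>,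
  extended by zero.\<close>

lemma bounded_linear_line:
  "bounded_linear (\<lambda>v. (c * cinner f v) *\<^sub>C (f::'a::complex_inner))"
proof (rule bounded_linear_intro[where K = "cmod c * norm f * norm f"])
  fix x y and r :: real
  show "(c * cinner f (x + y)) *\<^sub>C f = (c * cinner f x) *\<^sub>C f + (c * cinner f y) *\<^sub>C f"
    by (simp only: cinner_add_right scaleC_add_left distrib_left)
  show "(c * cinner f (r *\<^sub>R x)) *\<^sub>C f = r *\<^sub>R ((c * cinner f x) *\<^sub>C f)"
    by (simp only: scaleR_scaleC cinner_scaleC_right scaleC_scaleC mult.left_commute)
  have "cmod c * norm f * cmod (cinner f x) \<le> cmod c * norm f * (norm f * norm x)"
    by (rule mult_left_mono[OF norm_cinner_le]) simp
  then show "norm ((c * cinner f x) *\<^sub>C f) \<le> norm x * (cmod c * norm f * norm f)"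
    by (simp only: norm_scaleC norm_mult mult_ac)
qed

lift_definition line_op :: "'a::complex_inner \<Rightarrow> complex \<Rightarrow> 'a \<Rightarrow>\<^sub>L 'a" is
  "\<lambda>f c v. (c * cinner f v) *\<^sub>C f"
  by (rule bounded_linear_line)

text \<open>The first row of the matrix, with entries \<open>\<i> x0\<close>, \<open>x\<close>, \<open>- x*\<close>, \<open>Y\<close> (inside the range of
  the projection) and \<open>A\<close>. Its domain is the whole space and its codomain is the range of the
  projection; as an operator into the whole space it has the same norm.\<close>

definition row_op :: "'a::complex_inner \<Rightarrow> real \<Rightarrow> ('a \<Rightarrow>\<^sub>L 'a) \<Rightarrow> ('a \<Rightarrow>\<^sub>L 'a) \<Rightarrow> ('a \<Rightarrow>\<^sub>L 'a) \<Rightarrow> 'a \<Rightarrow>\<^sub>L 'a"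
  where "row_op f x0 x Y A = line_op f (\<i> * complex_of_real x0) + x - cadjoint x + Y + A"

definition block_op ::
    "'a::complex_inner \<Rightarrow> real \<Rightarrow> ('a \<Rightarrow>\<^sub>L 'a) \<Rightarrow> ('a \<Rightarrow>\<^sub>L 'a) \<Rightarrow> ('a \<Rightarrow>\<^sub>L 'a) \<Rightarrow> ('a \<Rightarrow>\<^sub>L 'a) \<Rightarrow> 'a \<Rightarrow>\<^sub>L 'a"
  where "block_op f x0 x Y A Z = row_op f x0 x Y A + (- cadjoint A + Z)"

text \<open>\<open>x0\<close>, \<open>x\<close>, \<open>A\<close> are the matrix entries determined by \<open>V\<close>.\<close>

definition lifting_entries ::
    "('a::complex_inner \<Rightarrow>\<^sub>L 'a) \<Rightarrow> 'a \<Rightarrow> ('a \<Rightarrow>\<^sub>L 'a) \<times> 'a \<Rightarrow> real \<Rightarrow> ('a \<Rightarrow>\<^sub>L 'a) \<Rightarrow> ('a \<Rightarrow>\<^sub>L 'a) \<Rightarrow> bool"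
  where "lifting_entries P f V x0 x A \<longleftrightarrow>
    x \<in> ops (rng_minus P f) (cline f) \<and> A \<in> ops (nul P) (rng P) \<and>
    liftings P f V = {block_op f x0 x Y A Z |Y Z. Y \<in> antiherm_on (rng_minus P f) \<and> Z \<in> antiherm_on (nul P)}"

text \<open>Every tangent vector determines such entries.\<close>

lemma orth_projectionsD:
  fixes P :: "'a::complex_inner \<Rightarrow>\<^sub>L 'a"
  assumes "P \<in> orth_projections"
  shows "P (c *\<^sub>C v) = c *\<^sub>C P v" "P (P v) = P v" "cinner (P v) w = cinner v (P w)"
  using assms blinfun_apply_blinfun_compose[of P P v]
  by (auto simp: orth_projections_def clinear_op_def is_adjoint_def)

lemma orth_projectionsI:
  fixes P :: "'a::complex_inner \<Rightarrow>\<^sub>L 'a"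
  assumes "\<And>c v. P (c *\<^sub>C v) = c *\<^sub>C P v" "\<And>v. P (P v) = P v"
    "\<And>v w. cinner (P v) w = cinner v (P w)"
  shows "P \<in> orth_projections"
  using assms by (auto simp: orth_projections_def clinear_op_def is_adjoint_def intro!: blinfun_eqI)

lemma ops_proj_iff:
  fixes B E F :: "'a::complex_inner \<Rightarrow>\<^sub>L 'a"
  assumes E: "E \<in> orth_projections" and F: "F \<in> orth_projections"
  shows "B \<in> ops (rng E) (rng F) \<longleftrightarrow> clinear_op B \<and> (\<forall>v. F (B v) = B v) \<and> (\<forall>v. B (E v) = B v)"
proof -
  have 1: "w \<in> rng F \<longleftrightarrow> F w = w" for w
    using orth_projectionsD(2)[OF F] by (auto simp: rng_def) (metis rangeI)
  have 2: "v \<in> ortho (rng E) \<longleftrightarrow> E v = 0" for v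
  proof
    assume "v \<in> ortho (rng E)"
    then have "cinner (E v) v = 0" by (auto simp: ortho_def rng_def)
    then have "cinner (E v) (E v) = 0" by (metis orth_projectionsD(2,3)[OF E])
    then show "E v = 0" by (simp add: cinner_self)
  qed (auto simp: ortho_def rng_def orth_projectionsD(3)[OF E])
  have 3: "(\<forall>v. E v = 0 \<longrightarrow> B v = 0) \<longleftrightarrow> (\<forall>v. B (E v) = B v)"
  proof
    assume *: "\<forall>v. E v = 0 \<longrightarrow> B v = 0"
    show "\<forall>v. B (E v) = B v"
    proof
      fix v
      have "E (E v - v) = 0" by (simp add: blinfun.diff_right orth_projectionsD(2)[OF E])
      with * have "B (E v - v) = 0" by blast
      then show "B (E v) = B v" by (simp add: blinfun.diff_right)
    qed
  qed (metis blinfun.zero_right)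
  show ?thesis using 1 2 3 by (auto simp: ops_def)
qed

lemma antiherm_on_iff:
  fixes X :: "'a::complex_inner \<Rightarrow>\<^sub>L 'a"
  shows "X \<in> antiherm_on S \<longleftrightarrow> X \<in> ops S S \<and> (\<forall>v w. cinner (X v) w = - cinner v (X w))"
  by (auto simp: antiherm_on_def is_adjoint_def blinfun.minus_left minus_equation_iff)

lemma antiherm_on_UNIV_iff:
  fixes X :: "'a::complex_inner \<Rightarrow>\<^sub>L 'a"
  shows "X \<in> antiherm_on UNIV \<longleftrightarrow> clinear_op X \<and> (\<forall>v w. cinner (X v) w = - cinner v (X w))"
proof -
  have "v = 0" if "v \<in> ortho UNIV" for v :: 'a
  proof -
    have "cinner v v = 0" using that by (simp add: ortho_def)
    then show ?thesis by (simp add: cinner_self)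
  qed
  then show ?thesis
    by (auto simp: antiherm_on_def ops_def is_adjoint_def blinfun.minus_left minus_equation_iff)
      (metis blinfun.zero_right)+
qed

lemma lifting_entries_exist:
  fixes P :: "'a::complex_inner \<Rightarrow>\<^sub>L 'a"
  assumes Pf: "(P, f) \<in> proj_vec_pairs" and V: "V \<in> tangent_space P f"
  shows "\<exists>x0 x A. lifting_entries P f V x0 x A"
proof -
  obtain X where X: "X \<in> antiherm_on UNIV" and V_eq: "V = delta P f X"
    using V by (auto simp: tangent_space_def)
  define p where "p = line_op f 1"
  define Q where "Q = P - p"
  define N where "N = id_blinfun - P"
  have P: "P \<in> orth_projections" and Pff: "P f = f" and nf: "norm f = 1"
    using Pf by (auto simp: proj_vec_pairs_def)
  have ff: "cinner f f = 1" by (simp add: cinner_self nf)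
  note PD = orth_projectionsD[OF P]
  have p_ap: "p v = cinner f v *\<^sub>C f" for v by (simp add: p_def line_op.rep_eq)
  have p: "p \<in> orth_projections"
  proof (rule orth_projectionsI)
    show "cinner (p v) w = cinner v (p w)" for v w
      unfolding p_ap cinner_scaleC_left cinner_scaleC_right
      using cinner_commute[of v f] by (simp add: mult.commute)
  qed (simp_all add: p_ap cinner_scaleC_right scaleC_scaleC ff)
  note pD = orth_projectionsD[OF p]
  have Pp: "P (p v) = p v" for v by (simp add: p_ap PD(1) Pff)
  have pP: "p (P v) = p v" for v by (simp add: p_ap PD(3)[symmetric] Pff)
  have Q_ap: "Q v = P v - p v" and N_ap: "N v = v - P v" for v
    by (simp_all add: Q_def N_def blinfun.diff_left)
  have Q: "Q \<in> orth_projections"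
    by (rule orth_projectionsI)
      (simp_all add: Q_ap PD pD blinfun.diff_right Pp pP scaleC_diff_right cinner_diff_left cinner_diff_right)
  have N: "N \<in> orth_projections"
    by (rule orth_projectionsI)
      (simp_all add: N_ap PD blinfun.diff_right scaleC_diff_right cinner_diff_left cinner_diff_right)
  note QD = orth_projectionsD[OF Q] and ND = orth_projectionsD[OF N]
  have rp: "cline f = rng p"
    unfolding cline_def rng_def
  proof (intro equalityI subsetI)
    fix v assume "v \<in> range (\<lambda>c. c *\<^sub>C f)"
    then obtain c where "v = c *\<^sub>C f" by auto
    then have "v = p v" by (simp add: p_ap cinner_scaleC_right ff)
    then show "v \<in> range p" by (metis rangeI)
  qed (auto simp: p_ap)
  have rN: "nul P = rng N"
    unfolding nul_def rng_def
  proof (intro equalityI subsetI)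
    fix v assume "v \<in> {v. P v = 0}"
    then have "v = N v" by (simp add: N_ap)
    then show "v \<in> range N" by (metis rangeI)
  qed (auto simp: N_ap blinfun.diff_right PD)
  have rQ: "rng_minus P f = rng Q"
    unfolding rng_minus_def
  proof (intro equalityI subsetI)
    fix v assume v: "v \<in> rng P \<inter> ortho (cline f)"
    then have "P v = v" using PD(2) by (auto simp: rng_def)
    moreover have "f \<in> cline f" unfolding cline_def by (metis rangeI scaleC_one)
    then have "cinner f v = 0" using v by (auto simp: ortho_def)
    then have "p v = 0" by (simp add: p_ap)
    ultimately have "v = Q v" by (simp add: Q_ap)
    then show "v \<in> rng Q" unfolding rng_def by (metis rangeI)
  next
    fix v assume "v \<in> rng Q"
    then obtain w where w: "v = Q w" by (auto simp: rng_def)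
    then have "P v = v" by (simp add: Q_ap blinfun.diff_right PD Pp)
    then have "v \<in> rng P" unfolding rng_def by (metis rangeI)
    moreover have "p v = 0" by (simp add: w Q_ap blinfun.diff_right pD pP)
    then have "cmod (cinner f v) * norm f = 0" by (metis p_ap norm_scaleC norm_zero)
    then have "cinner f v = 0" by (simp add: nf)
    then have "v \<in> ortho (cline f)" by (auto simp: ortho_def cline_def cinner_scaleC_left)
    ultimately show "v \<in> rng P \<inter> ortho (cline f)" by blast
  qed
  have Xc: "X (c *\<^sub>C v) = c *\<^sub>C X v" and Xa: "cinner (X v) w = - cinner v (X w)" for c v w
    using X by (auto simp: antiherm_on_UNIV_iff clinear_op_def)
  define x0 where "x0 = Im (cinner f (X f))"
  define x where "x = p o\<^sub>L X o\<^sub>L Q"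
  define A where "A = P o\<^sub>L X o\<^sub>L N"
  have "cinner f (X f) = - cnj (cinner f (X f))"
    by (metis Xa cinner_commute minus_minus)
  then have "Re (cinner f (X f)) = 0"
    by (metis complex_cnj(1) complex_surj minus_complex.sel(1) uminus_complex.sel(1) equal_neg_zero cnj.sel(1))
  then have ix0: "\<i> * complex_of_real x0 = cinner f (X f)"
    by (simp add: x0_def complex_eq_iff)
  have line: "line_op f (\<i> * complex_of_real x0) v = p (X (p v))" for v
    by (simp add: line_op.rep_eq ix0 p_ap Xc cinner_scaleC_right mult.commute)
  have adx: "cadjoint x = - (Q o\<^sub>L X o\<^sub>L p)"
    by (rule cadjoint_eqI)
      (simp add: is_adjoint_def x_def blinfun.minus_left QD(3) pD(3) Xa)
  have adA: "cadjoint A = - (N o\<^sub>L X o\<^sub>L P)"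
    by (rule cadjoint_eqI)
      (simp add: is_adjoint_def A_def blinfun.minus_left ND(3) PD(3) Xa)
  have block: "block_op f x0 x Y A Z v =
      p (X (p v)) + p (X (Q v)) + Q (X (p v)) + Y v + P (X (N v)) + N (X (P v)) + Z v" for Y Z :: "'a \<Rightarrow>\<^sub>L 'a" and v
    by (simp add: block_op_def row_op_def blinfun.add_left blinfun.diff_left blinfun.minus_left
        line adx adA) (simp add: x_def A_def)
  have blockX: "block_op f x0 x Y A Z v = X v - Q (X (Q v)) - N (X (N v)) + Y v + Z v" for Y Z :: "'a \<Rightarrow>\<^sub>L 'a" and v
    unfolding block by (simp add: Q_ap N_ap blinfun.diff_right)
  have Y_iff: "Y \<in> antiherm_on (rng_minus P f) \<longleftrightarrow> Y \<in> antiherm_on UNIV \<and>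
      (\<forall>v. Q (Y v) = Y v) \<and> (\<forall>v. Y (Q v) = Y v)" for Y :: "'a \<Rightarrow>\<^sub>L 'a"
    unfolding rQ antiherm_on_UNIV_iff antiherm_on_iff[of Y "rng Q"] ops_proj_iff[OF Q Q] by blast
  have Z_iff: "Z \<in> antiherm_on (nul P) \<longleftrightarrow> Z \<in> antiherm_on UNIV \<and>
      (\<forall>v. N (Z v) = Z v) \<and> (\<forall>v. Z (N v) = Z v)" for Z :: "'a \<Rightarrow>\<^sub>L 'a"
    unfolding rN antiherm_on_UNIV_iff antiherm_on_iff[of Z "rng N"] ops_proj_iff[OF N N] by blast
  have "x \<in> ops (rng_minus P f) (cline f)"
    unfolding rQ rp ops_proj_iff[OF Q p] by (simp add: x_def clinear_op_def QD pD Xc)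
  moreover have "A \<in> ops (nul P) (rng P)"
    unfolding rN ops_proj_iff[OF N P] by (simp add: A_def clinear_op_def ND PD Xc)
  moreover have "liftings P f V = {block_op f x0 x Y A Z |Y Z.
      Y \<in> antiherm_on (rng_minus P f) \<and> Z \<in> antiherm_on (nul P)}"
  proof (intro equalityI subsetI)
    fix W assume "W \<in> liftings P f V"
    then have W: "W \<in> antiherm_on UNIV" and dW: "delta P f W = delta P f X"
      by (auto simp: liftings_def V_eq)
    have Wc: "W (c *\<^sub>C v) = c *\<^sub>C W v" and Wa: "cinner (W v) w = - cinner v (W w)" for c v w
      using W by (auto simp: antiherm_on_UNIV_iff clinear_op_def)
    have Wf: "W f = X f" using dW by (simp add: delta_def)
    have WP: "(W o\<^sub>L P) - (P o\<^sub>L W) = (X o\<^sub>L P) - (P o\<^sub>L X)" using dW by (simp add: delta_def)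
    have comm: "W (P v) - P (W v) = X (P v) - P (X v)" for v
    proof -
      have "((W o\<^sub>L P) - (P o\<^sub>L W)) v = ((X o\<^sub>L P) - (P o\<^sub>L X)) v" by (simp only: WP)
      then show ?thesis by (simp only: blinfun.diff_left blinfun_apply_blinfun_compose)
    qed
    have Wp: "W (p v) = X (p v)" for v by (simp add: p_ap Wc Xc Wf)
    have pW: "p (W v) = p (X v)" for v
    proof -
      have "cinner f (W v) = cinner f (X v)" using Wa[of f v] Xa[of f v] Wf by simp
      then show ?thesis by (simp add: p_ap)
    qed
    have NWP: "N (W (P v)) = N (X (P v))" for v
    proof -
      have "W (P v) - P (W (P v)) = X (P v) - P (X (P v))" using comm[of "P v"] by (simp add: PD(2))
      then show ?thesis by (simp add: N_ap)
    qed
    have PWN: "P (W (N v)) = P (X (N v))" for v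
    proof -
      have "P (N v) = 0" by (simp add: N_ap blinfun.diff_right PD(2))
      then show ?thesis using comm[of "N v"] by (simp add: blinfun.zero_right)
    qed
    let ?Y = "Q o\<^sub>L W o\<^sub>L Q" and ?Z = "N o\<^sub>L W o\<^sub>L N"
    have "W = block_op f x0 x ?Y A ?Z"
    proof (rule blinfun_eqI)
      fix v
      have "block_op f x0 x ?Y A ?Z v =
        p (W (p v)) + p (W (Q v)) + Q (W (p v)) + Q (W (Q v)) + P (W (N v)) + N (W (P v)) + N (W (N v))"
        unfolding block by (simp add: Wp pW NWP PWN)
      also have "\<dots> = W v" by (simp add: Q_ap N_ap blinfun.diff_right)
      finally show "W v = block_op f x0 x ?Y A ?Z v" ..
    qed
    moreover have "?Y \<in> antiherm_on (rng_minus P f)"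
      unfolding Y_iff antiherm_on_UNIV_iff by (simp add: clinear_op_def QD Wc Wa)
    moreover have "?Z \<in> antiherm_on (nul P)"
      unfolding Z_iff antiherm_on_UNIV_iff by (simp add: clinear_op_def ND Wc Wa)
    ultimately show "W \<in> {block_op f x0 x Y A Z |Y Z.
      Y \<in> antiherm_on (rng_minus P f) \<and> Z \<in> antiherm_on (nul P)}" by blast
  next
    fix W assume "W \<in> {block_op f x0 x Y A Z |Y Z.
      Y \<in> antiherm_on (rng_minus P f) \<and> Z \<in> antiherm_on (nul P)}"
    then obtain Y Z where W: "W = block_op f x0 x Y A Z"
      and Y: "Y \<in> antiherm_on (rng_minus P f)" and Z: "Z \<in> antiherm_on (nul P)" by blast
    have Yc: "Y (c *\<^sub>C v) = c *\<^sub>C Y v" "cinner (Y v) w = - cinner v (Y w)" "Q (Y v) = Y v" "Y (Q v) = Y v"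
      and Zc: "Z (c *\<^sub>C v) = c *\<^sub>C Z v" "cinner (Z v) w = - cinner v (Z w)" "N (Z v) = Z v" "Z (N v) = Z v"
      for c v w
      using Y Z by (auto simp: Y_iff Z_iff antiherm_on_UNIV_iff clinear_op_def)
    have W_ap: "W v = X v - Q (X (Q v)) - N (X (N v)) + Y v + Z v" for v
      unfolding W by (rule blockX)
    have "W \<in> antiherm_on UNIV"
      unfolding antiherm_on_UNIV_iff clinear_op_def W_ap
      by (simp add: QD ND Xc Yc Zc Xa scaleC_add_right scaleC_diff_right cinner_add_left
          cinner_add_right cinner_diff_left cinner_diff_right)
    moreover have "W f = X f"
    proof -
      have "Q f = 0" "N f = 0" by (simp_all add: Q_ap N_ap Pff p_ap ff)
      moreover have "Y f = 0" "Z f = 0" using Yc(4)[of f] Zc(4)[of f] calculation by simp_all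
      ultimately show ?thesis by (simp add: W_ap)
    qed
    moreover have "(W o\<^sub>L P) - (P o\<^sub>L W) = (X o\<^sub>L P) - (P o\<^sub>L X)"
    proof (rule blinfun_eqI)
      fix v
      have a: "Q (P u) = Q u" "P (Q u) = Q u" "N (P u) = 0" "P (N u) = 0" for u
        by (simp_all add: Q_ap N_ap blinfun.diff_right PD(2) Pp pP)
      have b: "Y (P v) = Y v" "P (Y v) = Y v" "Z (P v) = 0" "P (Z v) = 0"
        using Yc(3,4) Zc(3,4) a by (metis, metis, metis blinfun.zero_right, metis)
      show "((W o\<^sub>L P) - (P o\<^sub>L W)) v = ((X o\<^sub>L P) - (P o\<^sub>L X)) v"
        by (simp add: blinfun.diff_left W_ap blinfun.diff_right blinfun.add_right a b)
    qed
    ultimately show "W \<in> liftings P f V" by (simp add: liftings_def V_eq delta_def)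
  qed
  ultimately show ?thesis unfolding lifting_entries_def by blast
qed

end

theory Submission
  imports Defs
begin

text \<open>
  The norm of a row is a lower bound for the norm of every matrix that has this row. All of the
  theorem follows once this bound is known to be attained, that is, once for every \<open>Y\<close> some
  anti-Hermitian \<open>Z\<close> makes the norm of the matrix equal to the norm of its first row
  (\<open>antiherm_completion\<close>, a form of Krein's extension theorem). The least norm of a lifting is then
  the least norm of a row, so a minimal lifting is the same thing as a norm-minimizing row together
  with a norm-minimizing completion of it.

  The completion is constructed as follows. Let \<open>X\<close> be any anti-Hermitian matrix with the given
  first row, let \<open>c\<close> be the norm of that row, \<open>M\<close> the range of the projection, and \<open>T = \<i>X\<close>. Taking
  adjoints, \<open>T\<close> is Hermitian and \<open>\<parallel>T m\<parallel> \<le> c \<parallel>m\<parallel>\<close> on \<open>M\<close>. The task is to correct \<open>T\<close> by a Hermitian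
  \<open>S\<close> that vanishes on \<open>M\<close> so that \<open>- c \<le> T + S \<le> c\<close> as quadratic forms. The largest form that
  is invariant under translation by \<open>M\<close> and respects the upper bound is
  \[ Q(v) = \inf_{m \in M} \; c \|v + m\|^2 - \langle T (v + m), v + m \rangle . \]
  The upper bound is the choice \<open>m = 0\<close>. For the lower bound put \<open>w = 2 v + m\<close>; the parallelogram
  law and the symmetry of \<open>T\<close> turn the required inequality for the single vector \<open>m\<close> into
  \[ \frac c2 \bigl(\|w\|^2 + \|m\|^2\bigr) - \langle T m, w \rangle \ge 0 , \]
  which is the Cauchy-Schwarz inequality together with \<open>\<parallel>T m\<parallel> \<le> c \<parallel>m\<parallel>\<close>.

  It remains to see that \<open>Q\<close> is the form of a bounded operator. An infimum of a quadratic form over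
  the cosets of a subspace still satisfies the parallelogram law
  (\<open>infimum_over_cosets_parallelogram\<close>), and by the argument of Jordan and von Neumann a bounded
  functional with this property comes from a symmetric operator
  (\<open>parallelogram_form_is_operator_form\<close>). These steps use only the real inner product; complex
  linearity of \<open>S\<close> is recovered at the end from the fact that the construction is canonical, hence
  commutes with multiplication by \<open>\<i>\<close>.
\<close>

section \<open>Bounded quadratic functionals and symmetric operators\<close>

text \<open>An additive function commutes with integer scaling, so its failure \<open>g t = f (t x) - t f x\<close> to
  commute with real scaling depends only on the fractional part of \<open>t\<close> and is therefore bounded.
  Since \<open>g (n t) = n g t\<close>, it vanishes.\<close>

lemma additive_bounded_imp_bounded_linear:
  fixes f :: "'a::real_normed_vector \<Rightarrow> real"
  assumes add: "\<And>x y. f (x + y) = f x + f y"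
    and bnd: "\<And>x. norm x \<le> 1 \<Longrightarrow> \<bar>f x\<bar> \<le> C"
  shows "bounded_linear f"
proof -
  interpret f: Modules.additive f by standard (rule add)
  have nat_scale: "f (real n *\<^sub>R x) = real n * f x" for n x
    by (induction n) (simp_all add: f.zero f.add scaleR_left_distrib distrib_right)
  have int_scale: "f (real_of_int k *\<^sub>R x) = real_of_int k * f x" for k x
    by (cases k rule: int_cases2) (simp_all add: nat_scale f.minus)
  have ball: "\<bar>f x\<bar> \<le> real N * C" if "norm x \<le> real N" "N > 0" for x N
  proof -
    have "f x = real N * f ((1 / real N) *\<^sub>R x)"
      using that nat_scale[of N "(1 / real N) *\<^sub>R x"] by simp
    moreover have "\<bar>f ((1 / real N) *\<^sub>R x)\<bar> \<le> C"
      using that by (intro bnd) (simp add: field_simps)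
    ultimately show ?thesis by (simp add: abs_mult mult_left_mono)
  qed
  have scale: "f (t *\<^sub>R x) = t * f x" for t x
  proof -
    define g where "g s = f (s *\<^sub>R x) - s * f x" for s
    obtain N :: nat where N: "norm x < real N" using reals_Archimedean2 by blast
    then have N0: "N > 0" by (metis norm_ge_zero not_le of_nat_0 gr0I)
    define B where "B = real N * C + \<bar>f x\<bar>"
    have small: "\<bar>g r\<bar> \<le> B" if "0 \<le> r" "r \<le> 1" for r
    proof -
      have "r * norm x \<le> 1 * norm x" using that by (intro mult_right_mono) auto
      then have "norm (r *\<^sub>R x) \<le> real N" using that N by simp
      then have "\<bar>f (r *\<^sub>R x)\<bar> \<le> real N * C" using N0 by (rule ball)
      moreover have "\<bar>r * f x\<bar> \<le> \<bar>f x\<bar>"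
        using that by (simp add: abs_mult mult_left_le_one_le)
      ultimately show ?thesis unfolding g_def B_def by linarith
    qed
    have "real n * \<bar>g t\<bar> \<le> B" for n
    proof -
      have "real n * g t = g (real n * t)"
        by (simp add: g_def nat_scale right_diff_distrib flip: scaleR_scaleR)
      also have "\<dots> = g (frac (real n * t))"
        by (simp add: g_def frac_def scaleR_left_diff_distrib f.diff int_scale left_diff_distrib)
      finally have "\<bar>real n * g t\<bar> = \<bar>g (frac (real n * t))\<bar>" by (rule arg_cong)
      also have "\<dots> \<le> B"
        by (rule small[OF frac_ge_0 less_imp_le[OF frac_lt_1]])
      finally show ?thesis by (simp add: abs_mult)
    qed
    then have "\<bar>g t\<bar> \<le> 0" by (meson reals_Archimedean3 not_le)
    then show ?thesis by (simp add: g_def)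
  qed
  show ?thesis
  proof (rule bounded_linear_intro[where K = C])
    show "norm (f x) \<le> norm x * C" for x
    proof (cases "x = 0")
      case False
      have "f x = norm x * f (sgn x)"
        using False scale[of "norm x" "sgn x"] by (simp add: sgn_div_norm)
      then show ?thesis using bnd[of "sgn x"]
        by (simp add: abs_mult mult_left_mono norm_sgn)
    qed (simp add: f.zero)
  qed (simp_all add: add scale)
qed

text \<open>The Jordan--von Neumann argument, followed by the Riesz representation theorem. The values of
  \<open>Q\<close> may have either sign. The conclusion gives the polarization rather than \<open>inner (S x) x = Q x\<close>,
  because every symmetry of \<open>Q\<close> is then visibly inherited by \<open>S\<close>.\<close>

lemma parallelogram_form_is_operator_form:
  fixes Q :: "'a::{real_inner, complete_space} \<Rightarrow> real"
  assumes par: "\<And>x y. Q (x + y) + Q (x - y) = 2 * Q x + 2 * Q y"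
    and bnd: "\<And>x. \<bar>Q x\<bar> \<le> K * (norm x)\<^sup>2" and K: "0 \<le> K"
  obtains S :: "'a \<Rightarrow>\<^sub>L 'a"
  where "\<And>x y. inner (S x) y = (Q (x + y) - Q (x - y)) / 4"
proof -
  define b where "b x y = (Q (x + y) - Q (x - y)) / 4" for x y
  have Q0: "Q 0 = 0" using bnd[of 0] by simp
  have Qm: "Q (- x) = Q x" for x using par[of 0 x] by (simp add: Q0)
  have sym: "b x y = b y x" for x y
    using Qm[of "x - y"] by (simp add: b_def add.commute)
  have add: "b x (y + z) = b x y + b x z" for x y z
    \<comment> \<open>The first two instances minus the last two: the mixed terms cancel.\<close>
    using par[of "x + y" z] par[of "x + z" y] par[of "x - y" z] par[of "x - z" y]
    by (simp add: b_def diff_divide_distrib) (simp add: algebra_simps)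
  have bsq: "\<bar>b x y\<bar> \<le> K * ((norm x)\<^sup>2 + (norm y)\<^sup>2) / 2" for x y
  proof -
    have "4 * \<bar>b x y\<bar> \<le> K * (norm (x + y))\<^sup>2 + K * (norm (x - y))\<^sup>2"
      using bnd[of "x + y"] bnd[of "x - y"] by (simp add: b_def)
    also have "\<dots> = 2 * (K * ((norm x)\<^sup>2 + (norm y)\<^sup>2))"
      by (simp add: power2_norm_eq_inner inner_simps inner_commute algebra_simps)
    finally show ?thesis by simp
  qed
  have lin: "bounded_linear (b x)" for x
  proof (rule additive_bounded_imp_bounded_linear[OF add])
    fix y :: 'a assume "norm y \<le> 1"
    then have "(norm y)\<^sup>2 \<le> 1" by (simp add: power_le_one)
    then have "K * ((norm x)\<^sup>2 + (norm y)\<^sup>2) / 2 \<le> K * ((norm x)\<^sup>2 + 1) / 2"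
      using K by (intro divide_right_mono mult_left_mono) auto
    then show "\<bar>b x y\<bar> \<le> K * ((norm x)\<^sup>2 + 1) / 2" using bsq[of x y] by linarith
  qed
  have scale: "b x (r *\<^sub>R y) = r * b x y" for x y r
    using linear_simps(5)[OF lin] by simp
  have bmul: "\<bar>b x y\<bar> \<le> K * norm x * norm y" for x y
  proof (cases "x = 0 \<or> y = 0")
    case True
    then show ?thesis using scale[of x 0 0] scale[of y 0 0] sym[of x y] by auto
  next
    case False
    have "b x y = norm x * norm y * b (sgn x) (sgn y)"
      using False scale[of x "norm y" "sgn y"] scale[of "sgn y" "norm x" "sgn x"]
      by (simp add: sgn_div_norm sym[of x] sym[of "_ /\<^sub>R norm x"])
    moreover have "\<bar>b (sgn x) (sgn y)\<bar> \<le> K"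
      using bsq[of "sgn x" "sgn y"] False by (simp add: norm_sgn)
    ultimately show ?thesis
      by (simp add: abs_mult mult.assoc mult.commute[of K] mult_left_mono)
  qed
  have "\<exists>z. \<forall>y. b x y = inner z y" for x
    by (rule riesz_real[OF lin])
  then obtain S where S: "\<And>x y. b x y = inner (S x) y" by metis
  have "bounded_linear S"
  proof (rule bounded_linear_intro[where K = K])
    fix x y :: 'a and r :: real
    have "inner (S (x + y)) z = inner (S x + S y) z" for z
      using add[of z x y] by (simp add: inner_add_left sym[of z] flip: S)
    then show "S (x + y) = S x + S y" by (metis vector_eq_rdot)
    have "inner (S (r *\<^sub>R x)) z = inner (r *\<^sub>R S x) z" for z
      using scale[of z r x] by (simp add: sym[of z] flip: S)
    then show "S (r *\<^sub>R x) = r *\<^sub>R S x" by (metis vector_eq_rdot)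
    have "norm (S x) * norm (S x) = b x (S x)"
      by (simp add: S power2_norm_eq_inner flip: power2_eq_square)
    also have "\<dots> \<le> (norm x * K) * norm (S x)"
      using bmul[of x "S x"] by (simp add: mult.commute)
    finally show "norm (S x) \<le> norm x * K"
      using K by (metis mult_right_le_imp_le norm_ge_zero mult_nonneg_nonneg order_le_less)
  qed
  then have "inner (Blinfun S x) y = (Q (x + y) - Q (x - y)) / 4" for x y
    by (simp add: bounded_linear_Blinfun_apply flip: S b_def)
  then show thesis by (rule that)
qed

text \<open>By polarization and the parallelogram law, applied to \<open>x\<close> and to the vector \<open>y\<close> in the direction
  of \<open>T x\<close> with the same norm as \<open>x\<close>.\<close>

lemma symmetric_norm_le:
  fixes T :: "'a::real_inner \<Rightarrow>\<^sub>L 'a"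
  assumes sym: "\<And>x y. inner (T x) y = inner x (T y)"
    and form: "\<And>x. \<bar>inner (T x) x\<bar> \<le> c * (norm x)\<^sup>2" and c: "0 \<le> c"
  shows "norm T \<le> c"
proof (rule norm_blinfun_bound[OF c])
  fix x
  show "norm (T x) \<le> c * norm x"
  proof (cases "T x = 0")
    case False
    then have x0: "x \<noteq> 0" by (auto simp: blinfun.zero_right)
    define y where "y = (norm x / norm (T x)) *\<^sub>R T x"
    have ny: "norm y = norm x" using False by (simp add: y_def)
    have "inner (T x) y = norm x * norm (T x)"
      using False by (simp add: y_def power2_norm_eq_inner[symmetric] power2_eq_square)
    moreover have "4 * inner (T x) y
        = inner (T (x + y)) (x + y) - inner (T (x - y)) (x - y)"
      using sym[of y x] by (simp add: blinfun.add_right blinfun.diff_right inner_simps inner_commute)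
    moreover have "\<dots> \<le> c * (norm (x + y))\<^sup>2 + c * (norm (x - y))\<^sup>2"
      using form[of "x + y"] form[of "x - y"] by linarith
    moreover have "\<dots> = 2 * c * ((norm x)\<^sup>2 + (norm y)\<^sup>2)"
      by (simp add: power2_norm_eq_inner inner_simps inner_commute algebra_simps)
    ultimately have "norm x * norm (T x) \<le> norm x * (c * norm x)"
      unfolding ny by (simp add: power2_eq_square algebra_simps)
    then show ?thesis using x0 by (simp add: mult_le_cancel_left)
  qed (use c in simp)
qed

section \<open>Norm-preserving completion of a symmetric operator\<close>

text \<open>Near-minimizers \<open>m\<close> for \<open>x\<close> and \<open>n\<close> for \<open>y\<close> yield the competitors \<open>m + n\<close> for \<open>x + y\<close> and
  \<open>m - n\<close> for \<open>x - y\<close>, which gives one inequality. The reverse inequality is the same one for the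
  pair \<open>x + y\<close>, \<open>x - y\<close>, whose sum and difference are \<open>2 x\<close> and \<open>2 y\<close>.\<close>

lemma infimum_over_cosets_parallelogram:
  fixes q :: "'a::real_vector \<Rightarrow> real"
  assumes M: "subspace M"
    and par: "\<And>x y. q (x + y) + q (x - y) = 2 * q x + 2 * q y"
    and bdd: "\<And>v. bdd_below ((\<lambda>m. q (v + m)) ` M)"
  defines "Q \<equiv> \<lambda>v. INF m\<in>M. q (v + m)"
  shows "Q (x + y) + Q (x - y) = 2 * Q x + 2 * Q y"
proof -
  have lower: "Q v \<le> q (v + m)" if "m \<in> M" for v m
    unfolding Q_def by (rule cINF_lower[OF bdd that])
  have near: "\<exists>m\<in>M. q (v + m) < Q v + e" if "e > 0" for v e
    using cINF_less_iff[OF _ bdd[of v], of "Q v + e"] that subspace_0[OF M]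
    by (auto simp: Q_def)
  have half: "Q (x + y) + Q (x - y) \<le> 2 * Q x + 2 * Q y" for x y
  proof (rule field_le_epsilon)
    fix e :: real assume e: "e > 0"
    obtain m n where m: "m \<in> M" "q (x + m) < Q x + e / 4"
      and n: "n \<in> M" "q (y + n) < Q y + e / 4"
      using near[of "e / 4"] e by (meson divide_pos_pos zero_less_numeral)
    have "Q (x + y) \<le> q ((x + y) + (m + n))" "Q (x - y) \<le> q ((x - y) + (m - n))"
      using m n M by (simp_all add: lower subspace_add subspace_diff)
    moreover have "q ((x + y) + (m + n)) + q ((x - y) + (m - n)) = 2 * q (x + m) + 2 * q (y + n)"
      using par[of "x + m" "y + n"] by (simp add: algebra_simps)
    ultimately show "Q (x + y) + Q (x - y) \<le> 2 * Q x + 2 * Q y + e" using m n by linarith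
  qed
  have Q2: "Q (2 *\<^sub>R v) = 4 * Q v" for v
  proof -
    have q2: "q (2 *\<^sub>R u) = 4 * q u" for u
      using par[of u u] par[of 0 0] by (simp add: scaleR_2)
    have "Q (2 *\<^sub>R v) \<ge> 4 * Q v"
      unfolding Q_def
    proof (rule cINF_greatest)
      show "M \<noteq> {}" using subspace_0[OF M] by blast
      fix m assume "m \<in> M"
      then have "(1/2) *\<^sub>R m \<in> M" by (rule subspace_scale[OF M])
      from lower[OF this, of v] q2[of "v + (1/2) *\<^sub>R m"]
      show "4 * (INF m\<in>M. q (v + m)) \<le> q (2 *\<^sub>R v + m)"
        by (simp add: scaleR_right_distrib Q_def)
    qed
    moreover have "Q (2 *\<^sub>R v) \<le> 4 * Q v"
    proof (rule field_le_epsilon)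
      fix e :: real assume e: "e > 0"
      obtain m where m: "m \<in> M" "q (v + m) < Q v + e / 4"
        using near[of "e / 4"] e by (meson divide_pos_pos zero_less_numeral)
      from lower[OF subspace_scale[OF M m(1), of 2], of "2 *\<^sub>R v"] q2[of "v + m"] m(2)
      show "Q (2 *\<^sub>R v) \<le> 4 * Q v + e" by (simp add: scaleR_right_distrib)
    qed
    ultimately show ?thesis by simp
  qed
  from half[of "x + y" "x - y"] Q2[of x] Q2[of y]
  have "2 * (2 * Q x + 2 * Q y) \<le> 2 * (Q (x + y) + Q (x - y))"
    by (simp add: scaleR_2)
  then show ?thesis using half[of x y] by simp
qed

text \<open>The real form of Krein's theorem, by the extremal choice of \<open>S\<close>: its form is the \<open>Q\<close> of the
  introduction. As \<open>Q\<close> is determined by \<open>T\<close>, \<open>M\<close>, \<open>c\<close> and the norm, \<open>S\<close> commutes with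
  every surjective linear isometry \<open>J\<close> that preserves these data; the case of interest is multiplication by \<open>\<i>\<close>.\<close>

lemma symmetric_completion:
  fixes T :: "'a::{real_inner, complete_space} \<Rightarrow>\<^sub>L 'a"
  assumes sym: "\<And>x y. inner (T x) y = inner x (T y)"
    and M: "subspace M" and c: "0 \<le> c"
    and TM: "\<And>m. m \<in> M \<Longrightarrow> norm (T m) \<le> c * norm m"
  obtains S :: "'a \<Rightarrow>\<^sub>L 'a" where "\<And>x y. inner (S x) y = inner x (S y)"
    and "\<And>m. m \<in> M \<Longrightarrow> S m = 0" and "norm (T + S) \<le> c"
    and "\<And>J. \<lbrakk>linear J; surj J; \<And>x. norm (J x) = norm x; J ` M = M;
            \<And>x. T (J x) = J (T x)\<rbrakk> \<Longrightarrow> \<forall>x. S (J x) = J (S x)"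
proof -
  define q where "q v = c * (norm v)\<^sup>2 - inner (T v) v" for v
  define Q where "Q v = (INF m\<in>M. q (v + m))" for v
  have ne: "M \<noteq> {}" using subspace_0[OF M] by blast
  have par: "q (x + y) + q (x - y) = 2 * q x + 2 * q y" for x y
    by (simp add: q_def power2_norm_eq_inner blinfun.add_right blinfun.diff_right inner_simps
        algebra_simps)
  \<comment> \<open>The key inequality: \<open>Q\<close> is bounded below, and by exactly what \<open>- c \<le> T + S\<close> requires.\<close>
  have low: "- c * (norm v)\<^sup>2 - inner (T v) v \<le> q (v + m)" if m: "m \<in> M" for v m
  proof -
    define w where "w = 2 *\<^sub>R v + m"
    have "inner (T m) w \<le> norm (T m) * norm w" by (rule norm_cauchy_schwarz)
    also have "\<dots> \<le> c * norm m * norm w" by (intro mult_right_mono TM m) simp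
    finally have 1: "inner (T m) w \<le> c * (norm m * norm w)" by (simp add: mult.assoc)
    have "0 \<le> c * (norm m - norm w)\<^sup>2" using c by simp
    also have "\<dots> = c * (norm m)\<^sup>2 + c * (norm w)\<^sup>2 - 2 * (c * (norm m * norm w))"
      by (simp add: power2_diff algebra_simps)
    also have "\<dots> \<le> c * (norm m)\<^sup>2 + c * (norm w)\<^sup>2 - 2 * inner (T m) w" using 1 by simp
    also have "\<dots> = 2 * (q (v + m) + c * (norm v)\<^sup>2 + inner (T v) v)"
      unfolding q_def w_def power2_norm_eq_inner using sym[of m v]
      by (simp add: blinfun.add_right inner_simps inner_commute algebra_simps)
    finally show ?thesis by simp
  qed
  have bdd: "bdd_below ((\<lambda>m. q (v + m)) ` M)" for v
    using low by (intro bdd_belowI2) auto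
  have Q_le: "Q v \<le> q (v + m)" if "m \<in> M" for v m
    unfolding Q_def by (rule cINF_lower[OF bdd that])
  have Q_up: "Q v \<le> c * (norm v)\<^sup>2 - inner (T v) v" for v
    using Q_le[OF subspace_0[OF M], of v] by (simp add: q_def)
  have Q_low: "- c * (norm v)\<^sup>2 - inner (T v) v \<le> Q v" for v
    unfolding Q_def by (rule cINF_greatest[OF ne low])
  have "\<bar>Q v\<bar> \<le> (c + norm T) * (norm v)\<^sup>2" for v
  proof -
    have "\<bar>inner (T v) v\<bar> \<le> norm (T v) * norm v" by (rule Cauchy_Schwarz_ineq2)
    also have "\<dots> \<le> norm T * norm v * norm v" by (intro mult_right_mono norm_blinfun) simp
    finally show ?thesis using Q_up[of v] Q_low[of v]
      by (simp add: algebra_simps power2_eq_square abs_le_iff)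
  qed
  moreover have Qpar: "Q (x + y) + Q (x - y) = 2 * Q x + 2 * Q y" for x y
    unfolding Q_def by (rule infimum_over_cosets_parallelogram[OF M par bdd])
  moreover have "0 \<le> c + norm T" using c by simp
  ultimately obtain S :: "'a \<Rightarrow>\<^sub>L 'a"
    where S: "\<And>x y. inner (S x) y = (Q (x + y) - Q (x - y)) / 4"
    using parallelogram_form_is_operator_form[of Q "c + norm T"] by blast
  have Q_M: "Q (v + m) = Q v" if m: "m \<in> M" for v m
  proof -
    have "(+) m ` M = M" using m M 
      by (auto simp: subspace_add image_iff intro!: bexI[of _ "_ - m"] subspace_diff)
    then have "Q v = (INF m'\<in>(+) m ` M. q (v + m'))" by (simp add: Q_def)
    then show ?thesis by (simp add: Q_def image_image add.assoc)
  qed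
  have Q0: "Q 0 = 0" using Q_up[of 0] Q_low[of 0] by simp
  have Qm: "Q (- v) = Q v" for v using Qpar[of 0 v] by (simp add: Q0)
  have SQ: "inner (S v) v = Q v" for v using Qpar[of v v] by (simp add: S Q0)
  have S_sym: "inner (S x) y = inner x (S y)" for x y
    using Qm[of "x - y"] by (simp add: S inner_commute[of x] add.commute)
  have S_M: "S m = 0" if m: "m \<in> M" for m
  proof -
    have "inner (S m) y = 0" for y
      using Q_M[OF m, of y] Q_M[OF m, of "- y"] Qm[of y] by (simp add: S add.commute)
    then show ?thesis by (metis inner_eq_zero_iff)
  qed
  have "norm (T + S) \<le> c"
  proof (rule symmetric_norm_le[OF _ _ c])
    show "inner ((T + S) x) y = inner x ((T + S) y)" for x y
      by (simp add: blinfun.add_left inner_simps sym S_sym)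
    show "\<bar>inner ((T + S) x) x\<bar> \<le> c * (norm x)\<^sup>2" for x
      using Q_up[of x] Q_low[of x] by (simp add: blinfun.add_left inner_simps SQ abs_le_iff)
  qed
  moreover have "\<forall>x. S (J x) = J (S x)"
    if J: "linear J" "surj J" "\<And>x. norm (J x) = norm x" "J ` M = M" "\<And>x. T (J x) = J (T x)" for J
  proof
    fix x
    interpret J: linear J by fact
    have JJ: "inner (J u) (J v) = inner u v" for u v
      using J(3)[of "u + v"] J(3)[of u] J(3)[of v]
      by (simp add: J.add norm_eq inner_simps inner_commute)
    have "q (J v) = q v" for v by (simp add: q_def J JJ)
    moreover have "Q (J v) = (INF m\<in>J ` M. q (J v + m))" for v by (simp add: Q_def J(4))
    ultimately have "Q (J v) = Q v" for v by (simp add: Q_def image_image flip: J.add)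
    then have *: "inner (S (J x)) (J y) = inner (J (S x)) (J y)" for y
      by (simp add: S JJ flip: J.add J.diff)
    have "inner (S (J x)) y = inner (J (S x)) y" for y
      using *[of "inv J y"] J(2) by (simp add: surj_f_inv_f)
    then show "S (J x) = J (S x)" by (metis vector_eq_rdot)
  qed
  ultimately show thesis using that[OF S_sym S_M] by blast
qed

section \<open>Completing the second row of an anti-Hermitian matrix\<close>

lemma orth_projection_norm_le:
  assumes P: "P \<in> orth_projections"
  shows "norm (P v) \<le> norm v"
proof -
  have "(norm (P v))\<^sup>2 = inner v (P v)"
    using orth_projectionsD(2,3)[OF P] by (simp add: power2_norm_eq_inner inner_eq_Re_cinner)
  also have "\<dots> \<le> norm v * norm (P v)" by (rule norm_cauchy_schwarz)
  finally show ?thesis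
    by (cases "P v = 0") (simp_all add: power2_eq_square)
qed

text \<open>The product \<open>P X\<close> is the first row of \<open>X\<close>, and adding \<open>Z\<close> changes only the lower right corner.
  Multiplication by \<open>\<i>\<close> translates between Hermitian and anti-Hermitian operators.\<close>

lemma antiherm_completion:
  fixes X P :: "'a::chilbert_space \<Rightarrow>\<^sub>L 'a"
  assumes X: "X \<in> antiherm_on UNIV" and P: "P \<in> orth_projections"
  obtains Z where "Z \<in> antiherm_on (nul P)" and "norm (X + Z) \<le> norm (P o\<^sub>L X)"
proof -
  note PD = orth_projectionsD[OF P]
  have Xc: "X (k *\<^sub>C v) = k *\<^sub>C X v" and Xa: "cinner (X v) w = - cinner v (X w)" for k v w
    using X by (auto simp: antiherm_on_UNIV_iff clinear_op_def)
  define I where "I = Blinfun (\<lambda>v::'a. \<i> *\<^sub>C v)"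
  have "bounded_linear (\<lambda>v::'a. \<i> *\<^sub>C v)"
    by (rule bounded_linear_intro[where K = 1])
      (simp_all add: scaleC_add_right scaleR_scaleC scaleC_scaleC mult.commute)
  then have I: "I v = \<i> *\<^sub>C v" for v by (simp add: I_def bounded_linear_Blinfun_apply)
  define c where "c = norm (P o\<^sub>L X)"
  define T where "T = I o\<^sub>L X"
  have T: "T v = \<i> *\<^sub>C X v" for v by (simp add: T_def I)
  define M where "M = rng P"
  have M_iff: "m \<in> M \<longleftrightarrow> P m = m" for m
    by (auto simp: M_def rng_def PD(2)) (metis rangeI)
  have "inner (T x) y = inner x (T y)" for x y
    by (simp add: T inner_eq_Re_cinner cinner_scaleC_left cinner_scaleC_right Xa)
  moreover have "subspace M"
    by (simp add: subspace_def M_iff blinfun.add_right blinfun.scaleR_right blinfun.zero_right)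
  moreover have "0 \<le> c" by (simp add: c_def)
  moreover have "norm (T m) \<le> c * norm m" if m: "m \<in> M" for m
  proof -
    \<comment> \<open>The first column of \<open>X\<close> is, up to sign, the adjoint of its first row.\<close>
    have "cinner (X m) (X m) = - cinner m (P (X (X m)))"
      using m PD(3)[of m "X (X m)"] by (simp add: Xa M_iff)
    then have "(norm (X m))\<^sup>2 = - inner m ((P o\<^sub>L X) (X m))"
      by (simp add: inner_eq_Re_cinner power2_norm_eq_inner)
    also have "\<dots> \<le> norm m * norm ((P o\<^sub>L X) (X m))"
      using Cauchy_Schwarz_ineq2[of m "(P o\<^sub>L X) (X m)"] by linarith
    also have "\<dots> \<le> norm m * (c * norm (X m))"
      unfolding c_def by (intro mult_left_mono norm_blinfun) simp
    finally have "norm (X m) \<le> c * norm m"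
      by (cases "X m = 0") (simp_all add: power2_eq_square c_def algebra_simps)
    then show ?thesis by (simp add: T)
  qed
  ultimately obtain S :: "'a \<Rightarrow>\<^sub>L 'a" where S: "\<And>x y. inner (S x) y = inner x (S y)"
    and SM: "\<And>m. m \<in> M \<Longrightarrow> S m = 0" and nS: "norm (T + S) \<le> c"
    and SJ: "\<And>J. \<lbrakk>linear J; surj J; \<And>x. norm (J x) = norm x; J ` M = M;
            \<And>x. T (J x) = J (T x)\<rbrakk> \<Longrightarrow> \<forall>x. S (J x) = J (S x)"
    using symmetric_completion[of T M c] by blast
  have Si: "S (\<i> *\<^sub>C v) = \<i> *\<^sub>C S v" for v
  proof -
    have inv: "I (- \<i> *\<^sub>C v) = v" for v by (simp add: I scaleC_scaleC)
    have IM: "I ` M = M"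
    proof (intro equalityI subsetI)
      fix v assume "v \<in> M"
      then have "- \<i> *\<^sub>C v \<in> M" by (simp add: M_iff PD(1))
      then show "v \<in> I ` M" using inv by (metis imageI)
    qed (auto simp: M_iff I PD(1))
    have "\<forall>x. S (I x) = I (S x)"
    proof (rule SJ)
      show "linear (blinfun_apply I)" 
        by (rule bounded_linear.linear[OF blinfun.bounded_linear_right])
      show "surj (blinfun_apply I)" using inv by (metis surjI)
    qed (use IM in \<open>simp_all add: I T Xc\<close>)
    then show ?thesis by (simp add: I)
  qed
  have Sc: "S (k *\<^sub>C v) = k *\<^sub>C S v" for k v
  proof -
    have k: "k *\<^sub>C u = Re k *\<^sub>R u + Im k *\<^sub>R (\<i> *\<^sub>C u)" for u :: 'a
      by (subst complex_eq[of k])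
        (simp add: scaleR_scaleC scaleC_scaleC scaleC_add_left mult.commute)
    show ?thesis unfolding k[of v] k[of "S v"]
      by (simp add: blinfun.add_right blinfun.scaleR_right Si)
  qed
  have Sh: "cinner (S x) y = cinner x (S y)" for x y
    using S[of x y] S[of "\<i> *\<^sub>C x" y] by (simp add: cinner_eq_inner Si)
  define Z where "Z = - (I o\<^sub>L S)"
  have Z: "Z v = - (\<i> *\<^sub>C S v)" for v by (simp add: Z_def I blinfun.minus_left)
  have PS: "P (S v) = 0" for v
  proof -
    have "cinner (P (S v)) w = cinner 0 w" for w
      using SM[of "P w"] by (simp add: PD Sh M_iff)
    then show ?thesis by (rule cinner_ext_left)
  qed
  have ZM: "Z v = 0" if "v \<in> ortho (nul P)" for v
  proof -
    have "v - P v \<in> nul P" by (simp add: nul_def blinfun.diff_right PD)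
    then have "cinner (v - P v) v = 0" using that by (simp add: ortho_def)
    moreover have "cinner (v - P v) (P v) = 0"
      by (simp add: cinner_diff_left PD)
    ultimately have "cinner (v - P v) (v - P v) = 0" by (simp add: cinner_diff_right)
    then have "P v = v" by (simp add: cinner_self)
    then show ?thesis using SM[of v] by (simp add: Z M_iff)
  qed
  have "Z \<in> antiherm_on (nul P)"
    unfolding antiherm_on_iff ops_def
    using ZM by (auto simp: clinear_op_def Z Sc Sh scaleC_scaleC mult.commute nul_def
        blinfun.minus_right PD(1) PS cinner_scaleC_left cinner_scaleC_right)
  moreover have "norm (X + Z) \<le> norm (P o\<^sub>L X)"
  proof (rule norm_blinfun_bound)
    fix v
    have "norm ((X + Z) v) = norm (\<i> *\<^sub>C (X + Z) v)" by simp
    also have "\<i> *\<^sub>C (X + Z) v = (T + S) v"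
      using scaleR_scaleC[of "-1" "S v", symmetric]
      by (simp add: blinfun.add_left Z T scaleC_diff_right scaleC_scaleC)
    also have "norm \<dots> \<le> norm (T + S) * norm v" by (rule norm_blinfun)
    also have "\<dots> \<le> norm (P o\<^sub>L X) * norm v" using nS by (simp add: c_def mult_right_mono)
    finally show "norm ((X + Z) v) \<le> norm (P o\<^sub>L X) * norm v" .
  qed simp
  ultimately show thesis by (rule that)
qed

section \<open>Minimal liftings\<close>

text \<open>The entries of the first row map into the range of \<open>P\<close>, and \<open>A*\<close> and \<open>Z\<close> map into its kernel.
  For the adjoints \<open>x*\<close> and \<open>A*\<close> this is dual to where \<open>x\<close> and \<open>A\<close> vanish.\<close>

lemma row_op_eq_compose:
  fixes P x A :: "'a::chilbert_space \<Rightarrow>\<^sub>L 'a"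
  assumes Pf: "(P, f) \<in> proj_vec_pairs"
    and x: "x \<in> ops (rng_minus P f) (cline f)" and A: "A \<in> ops (nul P) (rng P)"
    and Y: "Y \<in> antiherm_on (rng_minus P f)" and Z: "Z \<in> antiherm_on (nul P)"
  shows "P o\<^sub>L block_op f x0 x Y A Z = row_op f x0 x Y A"
proof (rule blinfun_eqI)
  fix v
  have P: "P \<in> orth_projections" and f: "P f = f"
    using Pf by (auto simp: proj_vec_pairs_def)
  note PD = orth_projectionsD[OF P]
  have rngP: "P w = w" if "w \<in> rng P" for w
    using that by (auto simp: rng_def PD)
  have "is_adjoint (cadjoint x) x" "is_adjoint (cadjoint A) A"
    using x A by (auto simp: ops_def intro: is_adjoint_cadjoint)
  then have adx: "cinner (cadjoint x u) w = cinner u (x w)"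
    and adA: "cinner (cadjoint A u) w = cinner u (A w)" for u w
    by (auto simp: is_adjoint_def)
  have Px: "P (cadjoint x u) = cadjoint x u" for u
  proof (rule cinner_ext_left)
    fix w
    have "cinner s w = cinner s (P w)" if "s \<in> rng_minus P f" for s
      using that PD(3)[of s w] rngP[of s] by (simp add: rng_minus_def)
    then have "w - P w \<in> ortho (rng_minus P f)" by (simp add: ortho_def cinner_diff_right)
    then have "x (w - P w) = 0" using x by (simp add: ops_def)
    then have "x w = x (P w)" by (simp add: blinfun.diff_right)
    then show "cinner (P (cadjoint x u)) w = cinner (cadjoint x u) w"
      by (simp add: PD adx)
  qed
  have PA: "P (cadjoint A u) = 0" for u
  proof (rule cinner_ext_left)
    fix w
    have "P w \<in> ortho (nul P)" by (simp add: ortho_def nul_def flip: PD(3))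
    then have "A (P w) = 0" using A by (simp add: ops_def)
    then show "cinner (P (cadjoint A u)) w = cinner 0 w" by (simp add: PD adA)
  qed
  have "x v \<in> cline f" "Y v \<in> rng P" "A v \<in> rng P" "Z v \<in> nul P"
    using x Y A Z by (auto simp: ops_def antiherm_on_def rng_minus_def)
  then have "P (x v) = x v" "P (Y v) = Y v" "P (A v) = A v" "P (Z v) = 0"
    by (auto simp: cline_def nul_def rngP PD f)
  then show "(P o\<^sub>L block_op f x0 x Y A Z) v = row_op f x0 x Y A v"
    by (simp add: block_op_def row_op_def blinfun.add_left blinfun.diff_left blinfun.minus_left
        blinfun.add_right blinfun.diff_right blinfun.minus_right Px PA line_op.rep_eq PD f)
qed

theorem proposition4p2:
  fixes P0 :: "'a::chilbert_space \<Rightarrow>\<^sub>L 'a" and f0 :: 'a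
    and V :: "('a \<Rightarrow>\<^sub>L 'a) \<times> 'a"
    and x0 :: real and x A :: "'a \<Rightarrow>\<^sub>L 'a"
  assumes "(P0, f0) \<in> proj_vec_pairs"
    and "V \<in> tangent_space P0 f0"
    and "lifting_entries P0 f0 V x0 x A"
  shows
    "(\<forall>Y0 Z0.
        is_arg_min (\<lambda>Y. norm (row_op f0 x0 x Y A)) (\<lambda>Y. Y \<in> antiherm_on (rng_minus P0 f0)) Y0 \<and>
        is_arg_min (\<lambda>Z. norm (block_op f0 x0 x Y0 A Z)) (\<lambda>Z. Z \<in> antiherm_on (nul P0)) Z0
        \<longrightarrow> minimal_lifting P0 f0 V (block_op f0 x0 x Y0 A Z0)) \<and>
     (\<forall>X. minimal_lifting P0 f0 V X \<longrightarrow>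
        (\<exists>Y0 Z0.
          is_arg_min (\<lambda>Y. norm (row_op f0 x0 x Y A)) (\<lambda>Y. Y \<in> antiherm_on (rng_minus P0 f0)) Y0 \<and>
          is_arg_min (\<lambda>Z. norm (block_op f0 x0 x Y0 A Z)) (\<lambda>Z. Z \<in> antiherm_on (nul P0)) Z0 \<and>
          X = block_op f0 x0 x Y0 A Z0))"
proof -
  define L where "L = antiherm_on (rng_minus P0 f0)"
  define N where "N = antiherm_on (nul P0)"
  define row where "row = (\<lambda>Y. row_op f0 x0 x Y A)"
  define block where "block = (\<lambda>Y Z. block_op f0 x0 x Y A Z)"
  have P: "P0 \<in> orth_projections" using assms(1) by (simp add: proj_vec_pairs_def)
  have x: "x \<in> ops (rng_minus P0 f0) (cline f0)" and A: "A \<in> ops (nul P0) (rng P0)"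
    and lift: "liftings P0 f0 V = {block Y Z |Y Z. Y \<in> L \<and> Z \<in> N}"
    using assms(3) by (auto simp: lifting_entries_def L_def N_def block_def)
  have compress: "P0 o\<^sub>L block Y Z = row Y" if "Y \<in> L" "Z \<in> N" for Y Z
    using row_op_eq_compose[OF assms(1) x A] that by (simp add: L_def N_def row_def block_def)
  have row_le: "norm (row Y) \<le> norm (block Y Z)" if "Y \<in> L" "Z \<in> N" for Y Z
  proof -
    have "norm P0 \<le> 1" using orth_projection_norm_le[OF P] by (intro norm_blinfun_bound) simp_all
    then have "norm P0 * norm (block Y Z) \<le> 1 * norm (block Y Z)"
      by (intro mult_right_mono) simp_all
    then show ?thesis
      using norm_blinfun_compose[of P0 "block Y Z"] compress[OF that] by simp
  qed
  have completion: "\<exists>Z\<in>N. norm (block Y Z) \<le> norm (row Y)" if Y: "Y \<in> L" for Y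
  proof -
    have zero: "0 \<in> N"
      by (simp add: N_def antiherm_on_iff ops_def clinear_op_def nul_def blinfun.zero_right)
    then have "block Y 0 \<in> antiherm_on UNIV"
      using lift Y by (auto simp: liftings_def)
    then obtain Z where "Z \<in> N" "norm (block Y 0 + Z) \<le> norm (P0 o\<^sub>L block Y 0)"
      using antiherm_completion[OF _ P] unfolding N_def by blast
    moreover have "block Y 0 + Z = block Y Z" by (simp add: block_def block_op_def)
    ultimately show ?thesis using compress[OF Y zero] by auto
  qed
  have min_iff: "is_arg_min g R a \<longleftrightarrow> R a \<and> (\<forall>b. R b \<longrightarrow> g a \<le> g b)"
    for g :: "('a \<Rightarrow>\<^sub>L 'a) \<Rightarrow> real" and R a
    by (auto simp: is_arg_min_linorder)
  show ?thesis
    unfolding minimal_lifting_def min_iff lift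
    unfolding L_def[symmetric] N_def[symmetric]
    unfolding row_def[symmetric, THEN fun_cong] block_def[symmetric, THEN fun_cong, THEN fun_cong]
  proof (intro conjI allI impI)
    fix Y0 Z0
    assume *: "(Y0 \<in> L \<and> (\<forall>Y. Y \<in> L \<longrightarrow> norm (row Y0) \<le> norm (row Y))) \<and>
      Z0 \<in> N \<and> (\<forall>Z. Z \<in> N \<longrightarrow> norm (block Y0 Z0) \<le> norm (block Y0 Z))"
    then show "block Y0 Z0 \<in> {block Y Z |Y Z. Y \<in> L \<and> Z \<in> N}" by blast
    fix W assume "W \<in> {block Y Z |Y Z. Y \<in> L \<and> Z \<in> N}"
    then obtain Y Z where W: "W = block Y Z" "Y \<in> L" "Z \<in> N" by blast
    obtain Z1 where "Z1 \<in> N" "norm (block Y0 Z1) \<le> norm (row Y0)"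
      using completion * by blast
    then have "norm (block Y0 Z0) \<le> norm (row Y0)" using * order_trans by blast
    also have "\<dots> \<le> norm (row Y)" using * W by blast
    also have "\<dots> \<le> norm W" using row_le W by blast
    finally show "norm (block Y0 Z0) \<le> norm W" .
  next
    fix X
    assume *: "X \<in> {block Y Z |Y Z. Y \<in> L \<and> Z \<in> N} \<and>
      (\<forall>W. W \<in> {block Y Z |Y Z. Y \<in> L \<and> Z \<in> N} \<longrightarrow> norm X \<le> norm W)"
    then obtain Y0 Z0 where X: "X = block Y0 Z0" "Y0 \<in> L" "Z0 \<in> N" by blast
    have le: "norm (block Y0 Z0) \<le> norm (block Y Z)" if "Y \<in> L" "Z \<in> N" for Y Z
      using conjunct2[OF *, rule_format, of "block Y Z"] X(1) that by blast
    have "norm (row Y0) \<le> norm (row Y)" if Y: "Y \<in> L" for Y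
    proof -
      obtain Z where "Z \<in> N" "norm (block Y Z) \<le> norm (row Y)" using completion[OF Y] by blast
      then show ?thesis using le[OF Y] row_le[OF X(2,3)] by fastforce
    qed
    then show "\<exists>Y0 Z0. (Y0 \<in> L \<and> (\<forall>Y. Y \<in> L \<longrightarrow> norm (row Y0) \<le> norm (row Y))) \<and>
      (Z0 \<in> N \<and> (\<forall>Z. Z \<in> N \<longrightarrow> norm (block Y0 Z0) \<le> norm (block Y0 Z))) \<and> X = block Y0 Z0"
      using X le by blast
  qed
qed

end
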